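(* Let $\mathcal A=\mathbb{ISP}(\mathcal M)$, $\mathsf U:\mathcal A\to\mathcal D_u$ and $\Omega=\bigcup_{\mathbf M\in\mathcal M}\Omega_{\mathbf M}$ satisfy (A1)–(A3) of the context. Assume also: (S1) there exist a sort $\mathbf M_1\in\mathcal M$ having a $1$-element subalgebra $\{d_1\}\subseteq \mathbf M_1$ and $\omega\in\Omega_{\mathbf M_1}$ such that $\omega(d_1)=1$; (S0) there exist a sort $\mathbf M_0\in\mathcal M$ having a $1$-element subalgebra $\{d_0\}\subseteq\mathbf M_0$ and $\omega\in\Omega_{\mathbf M_0}$ such that $\omega(d_0)=0$. Let the multisorted structure $\underset{\sim}{\mathcal M}=(N;G,R\cup S,\mathcal T)$ be constructed as follows. (U) The universe $N$ is $\bigsqcup\{M\mid \mathbf M\in\mathcal M\}$, the disjoint union of the universes of the members of $\mathcal M$. (G) $G\subseteq\bigcup\{\mathcal A(\mathbf M,\mathbf M')\mid \mathbf M,\mathbf M'\in\mathcal M\}$ is a set of homomorphisms such that the separation condition $\mathrm{Sep}_{\mathcal M,G,\Omega}$ is satisfied. (R) $R=\bigcup_{\omega,\omega'\in\Omega}R_{\omega,\omega'}$, where, for $\omega\in\Omega_{\mathbf M}$ and $\omega'\in\Omega_{\mathbf M'}$, $R_{\omega,\omega'}$ is the set of all (universes of) maximal subalgebras of $(\omega,\omega')^{-1}(\leqslant)=\{(a,b)\in\mathbf M\times\mathbf M'\mid \omega(a)\leqslant\omega'(b)\}$. (T) $\mathcal T$ is the union topology on $N$ obtained when each $M$ (for $\mathbf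 M\in\mathcal M$) is discretely topologised. (S) The members of $S$ are the universes of the $1$-element subalgebras $\{d_1\}$ and $\{d_0\}$ of the sorts $\mathbf M_1$ and $\mathbf M_0$, as supplied by (S1) and (S0). Then $\underset{\sim}{\mathcal M}$ yields a duality on $\mathcal A$; that is, for every $\mathbf A\in\mathcal A$ the evaluation map $e_{\mathbf A}:\mathbf A\to\mathsf E\mathsf D(\mathbf A)$ is an isomorphism.
   Context: $\mathcal D_u$ is the variety of (unbounded) distributive lattices, in the language $\{\vee,\wedge\}$ with no constants for bounds, made into a category with all lattice homomorphisms; $\mathcal D_u=\mathbb{ISP}(\mathbf 2)$ with $\mathbf 2=(\{0,1\};\vee,\wedge)$, $0<1$. Algebras are non-empty. Framework assumptions. (A1) There is a forgetful functor $\mathsf U:\mathcal A\to\mathcal D_u$ (each algebra in $\mathcal A$ has a reduct in $\mathcal D_u$, on the same universe, and $\mathsf U$ sends an algebra to this reduct and a homomorphism to the same underlying map). (A2) $\mathcal A$ is a finitely generated quasivariety or variety expressed in the form $\mathcal A=\mathbb{ISP}(\mathcal M)$, where $\mathcal M$ is a finite set of pairwise disjoint (formally, disjointified) finite algebras in $\mathcal A$, called sorts. Distinct sorts may be isomorphic. $M$ denotes the universe of $\mathbf M$, and $\mathcal A(\mathbf A,\mathbf B)$ the set of homomorphisms from $\mathbf A$ to $\mathbf B$. (A3) To each $\mathbf M\in\mathcal M$ is associated a chosen non-empty set $\Omega_{\mathbf M}\subseteq\mathcal D_u(\mathsf U(\mathbf M),\mathbf 2)$ of lattice homomorphisms (carriers),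 and $\Omega:=\bigcup_{\mathbf M\in\mathcal M}\Omega_{\mathbf M}$. Separation condition $\mathrm{Sep}_{\mathcal M,G,\Omega}$: for all $\mathbf M\in\mathcal M$ and all $a,b\in\mathbf M$ with $a\neq b$, either there exists $\omega\in\Omega_{\mathbf M}$ with $\omega(a)\ne\omega(b)$, or there exist $\mathbf M'\in\mathcal M$, $\omega'\in\Omega_{\mathbf M'}$ and $u\in\mathcal A(\mathbf M,\mathbf M')\cap G$ with $\omega'(u(a))\neq\omega'(u(b))$. A "maximal subalgebra of $(\omega,\omega')^{-1}(\leqslant)$" is a subalgebra of $\mathbf M\times\mathbf M'$ (in the language of $\mathcal A$) whose universe is contained in $(\omega,\omega')^{-1}(\leqslant)$ and is maximal, under inclusion, among such subalgebras; $R_{\omega,\omega'}$ may be empty or have several members. The dual adjunction. For $\mathbf A\in\mathcal A$, $\mathsf D(\mathbf A)$ is the multisorted topological structure $\mathbf X$ with sorts $\mathbf X_M=\mathcal A(\mathbf A,\mathbf M)$ ($\mathbf M\in\mathcal M$, disjoint union), each a closed subspace of $M^A$ with the product topology ($M$ discrete), and with pointwise structure: for $g\in G\cap \mathcal A(\mathbf M,\mathbf M')$, $g^{\mathbf X}:\mathbf X_M\to\mathbf X_{M'}$ is $x\mapsto g\circ x$; for $r\in R$ with $r\subseteq M\times M'$, $r^{\mathbf X}=\{(x,x')\in\mathbf X_M\times\mathbf X_{M'}\mid (x(a),x'(a))\in r\text{ for all }a\in\mathbf A\}$; for $s\in S$ with $s\subseteq M$, $s^{\mathbf X}=\{x\in\mathbf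 X_M\mid x(a)\in s\text{ for all }a\in \mathbf A\}$. A morphism $\alpha:\mathbf X\to\underset{\sim}{\mathcal M}$ is a continuous map with $\alpha(\mathbf X_M)\subseteq M$ for each sort $\mathbf M$ which preserves the members of $G$, $R$ and $S$. $\mathsf E(\mathbf X)$ is the set of all such morphisms, viewed as a subalgebra of $\prod\{\mathbf M^{\mathbf X_M}\mid\mathbf M\in\mathcal M\}$ (so it belongs to $\mathcal A$). The evaluation map is $e_{\mathbf A}(a)(x)=x(a)$; it is always an embedding. $\underset{\sim}{\mathcal M}$ yields a duality on $\mathcal A$ if $e_{\mathbf A}$ is surjective, and hence an isomorphism, for each $\mathbf A\in\mathcal A$. *)

theory Defs
  imports "HOL-Analysis.Function_Topology" "HOL-Analysis.Sum_Topology"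
begin

text \<open>A signature is an arity function \<open>ar :: 'f \<Rightarrow> nat\<close>. The interpretation of an operation symbol
  only matters on lists of elements of the carrier that have the right length.\<close>

record ('f, 'a) alg =
  carrier :: "'a set"
  opn :: "'f \<Rightarrow> 'a list \<Rightarrow> 'a"

definition args :: "('f \<Rightarrow> nat) \<Rightarrow> 'f \<Rightarrow> 'a set \<Rightarrow> 'a list set" where
  "args ar f A = {xs. set xs \<subseteq> A \<and> length xs = ar f}"

definition is_algebra :: "('f \<Rightarrow> nat) \<Rightarrow> ('f, 'a) alg \<Rightarrow> bool" where
  "is_algebra ar A \<longleftrightarrow> carrier A \<noteq> {} \<and>
     (\<forall>f. \<forall>xs \<in> args ar f (carrier A). opn A f xs \<in> carrier A)"

definition subalgebra :: "('f \<Rightarrow> nat) \<Rightarrow> 'a set \<Rightarrow> ('f, 'a) alg \<Rightarrow> bool" where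
  "subalgebra ar B A \<longleftrightarrow> B \<subseteq> carrier A \<and> is_algebra ar (A\<lparr>carrier := B\<rparr>)"

text \<open>Homomorphisms are extensional, so that a homomorphism is determined by its values on the
  carrier and \<open>hom ar A B\<close> is a subset of the topological power of \<open>carrier B\<close> used below.\<close>

definition hom :: "('f \<Rightarrow> nat) \<Rightarrow> ('f, 'a) alg \<Rightarrow> ('f, 'b) alg \<Rightarrow> ('a \<Rightarrow> 'b) set" where
  "hom ar A B = {h \<in> carrier A \<rightarrow>\<^sub>E carrier B.
     \<forall>f. \<forall>xs \<in> args ar f (carrier A). h (opn A f xs) = opn B f (map h xs)}"

definition iso :: "('f \<Rightarrow> nat) \<Rightarrow> ('f, 'a) alg \<Rightarrow> ('f, 'b) alg \<Rightarrow> ('a \<Rightarrow> 'b) set" where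
  "iso ar A B = {h \<in> hom ar A B. bij_betw h (carrier A) (carrier B)}"

definition prod_alg :: "'i set \<Rightarrow> ('i \<Rightarrow> ('f, 'a) alg) \<Rightarrow> ('f, 'i \<Rightarrow> 'a) alg" where
  "prod_alg I M = \<lparr>carrier = (\<Pi>\<^sub>E i\<in>I. carrier (M i)),
                   opn = (\<lambda>f xs. \<lambda>i\<in>I. opn (M i) f (map (\<lambda>x. x i) xs))\<rparr>"

definition pair_alg :: "('f, 'a) alg \<Rightarrow> ('f, 'b) alg \<Rightarrow> ('f, 'a \<times> 'b) alg" where
  "pair_alg A B = \<lparr>carrier = carrier A \<times> carrier B,
                   opn = (\<lambda>f xs. (opn A f (map fst xs), opn B f (map snd xs)))\<rparr>"

text \<open>\<open>ISP ar K M\<close> consists of the algebras with carrier in the type \<open>'a\<close> that are isomorphic to a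
  subalgebra of a product of members of the family \<open>M k\<close>, \<open>k \<in> K\<close>. The existential quantifier
  needs a fixed type of product indices; pairs of elements of the algebra suffice, because an
  embedding into a product of any size remains one after keeping, for each pair of distinct
  elements, a single coordinate that separates them. This is lemma \<open>ISP_I\<close> below, where the index
  type is arbitrary.\<close>

definition ISP :: "('f \<Rightarrow> nat) \<Rightarrow> 'k set \<Rightarrow> ('k \<Rightarrow> ('f, 'm) alg) \<Rightarrow> ('f, 'a) alg set" where
  "ISP ar K M = {A. is_algebra ar A \<and>
     (\<exists>(I :: ('a \<times> 'a) set) s B h. s \<in> I \<rightarrow> K \<and>
        subalgebra ar B (prod_alg I (\<lambda>i. M (s i))) \<and>
        h \<in> iso ar A ((prod_alg I (\<lambda>i. M (s i)))\<lparr>carrier := B\<rparr>))}"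

lemma ISP_I:
  fixes A :: "('f, 'a) alg" and I :: "'i set" and M :: "'k \<Rightarrow> ('f, 'm) alg"
  assumes A: "is_algebra ar A" and s: "s \<in> I \<rightarrow> K"
    and B: "subalgebra ar B (prod_alg I (\<lambda>i. M (s i)))"
    and h: "h \<in> iso ar A ((prod_alg I (\<lambda>i. M (s i)))\<lparr>carrier := B\<rparr>)"
  shows "A \<in> ISP ar K M"
proof -
  let ?P = "prod_alg I (\<lambda>i. M (s i))"
  define J where "J = {(a, b). a \<in> carrier A \<and> b \<in> carrier A \<and> a \<noteq> b}"
  define c where "c = (\<lambda>(a, b). SOME i. i \<in> I \<and> h a i \<noteq> h b i)"
  let ?Q = "prod_alg J (\<lambda>p. M (s (c p)))"
  define h' where "h' = (\<lambda>a\<in>carrier A. \<lambda>p\<in>J. h a (c p))"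
  have hB: "h a \<in> B" if "a \<in> carrier A" for a
    using h that by (auto simp: iso_def hom_def)
  have hP: "h a \<in> (\<Pi>\<^sub>E i\<in>I. carrier (M (s i)))" if "a \<in> carrier A" for a
    using hB[OF that] B by (auto simp: subalgebra_def prod_alg_def)
  have hop: "h (opn A f xs) = opn ?P f (map h xs)" if "xs \<in> args ar f (carrier A)" for f xs
    using h that by (auto simp: iso_def hom_def)
  have inj: "inj_on h (carrier A)"
    using h by (auto simp: iso_def bij_betw_def)
  have c: "c (a, b) \<in> I \<and> h a (c (a, b)) \<noteq> h b (c (a, b))" if "(a, b) \<in> J" for a b
  proof -
    have ab: "a \<in> carrier A" "b \<in> carrier A" "h a \<noteq> h b"
      using that inj by (auto simp: J_def inj_on_def)
    then obtain i where "i \<in> I" "h a i \<noteq> h b i"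
      using PiE_ext[OF hP hP] by blast
    then show ?thesis unfolding c_def prod.case by (intro someI[of "\<lambda>i. i \<in> I \<and> h a i \<noteq> h b i"]) auto
  qed
  have cI: "c p \<in> I" if "p \<in> J" for p using c that by (cases p) auto
  have h'Q: "h' a \<in> carrier ?Q" if "a \<in> carrier A" for a
    using hP[OF that] that cI by (auto simp: h'_def prod_alg_def PiE_def Pi_def)
  have closed: "opn A f xs \<in> carrier A" if "xs \<in> args ar f (carrier A)" for f xs
    using A that by (auto simp: is_algebra_def)
  have h'op: "h' (opn A f xs) = opn ?Q f (map h' xs)" if xs: "xs \<in> args ar f (carrier A)" for f xs
  proof -
    have "h' (opn A f xs) p = opn ?Q f (map h' xs) p" for p
    proof (cases "p \<in> J")
      case True
      have "map (\<lambda>x. x p) (map h' xs) = map (\<lambda>x. x (c p)) (map h xs)"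
        using xs True by (auto simp: h'_def args_def)
      then have "opn ?Q f (map h' xs) p = opn ?P f (map h xs) (c p)"
        using True cI[OF True] unfolding prod_alg_def by (simp del: map_map)
      also have "\<dots> = h' (opn A f xs) p"
        using hop[OF xs] closed[OF xs] True by (simp add: h'_def)
      finally show ?thesis by simp
    next
      case False
      then show ?thesis using closed[OF xs] by (simp add: h'_def prod_alg_def)
    qed
    then show ?thesis by blast
  qed
  have inj': "inj_on h' (carrier A)"
  proof (rule inj_onI, rule ccontr)
    fix a b assume ab: "a \<in> carrier A" "b \<in> carrier A" "h' a = h' b" "a \<noteq> b"
    then have J: "(a, b) \<in> J" by (simp add: J_def)
    have "h' a (c' ) = h' b c'" for c' using ab by simp
    from this[of "(a, b)"] c[OF J] show False using ab J by (simp add: h'_def)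
  qed
  let ?B = "h' ` carrier A"
  have lift: "\<exists>ys \<in> args ar f (carrier A). xs = map h' ys" if "xs \<in> args ar f ?B" for f xs
  proof -
    have "xs \<in> lists ?B" using that by (auto simp: args_def)
    then obtain ys where "ys \<in> lists (carrier A)" "xs = map h' ys" by (auto simp: lists_image)
    with that show ?thesis by (auto simp: args_def intro!: bexI[of _ ys])
  qed
  have "opn ?Q f xs \<in> ?B" if "xs \<in> args ar f ?B" for f xs
  proof -
    obtain ys where ys: "ys \<in> args ar f (carrier A)" "xs = map h' ys"
      using lift[OF \<open>xs \<in> args ar f ?B\<close>] by blast
    then have "opn ?Q f xs = h' (opn A f ys)" using h'op[OF ys(1)] by simp
    then show ?thesis using closed[OF ys(1)] by simp
  qed
  moreover have "?B \<subseteq> carrier ?Q" using h'Q by blast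
  moreover have "?B \<noteq> {}" using A by (simp add: is_algebra_def)
  ultimately have "subalgebra ar ?B ?Q"
    by (simp add: subalgebra_def is_algebra_def)
  moreover have "h' \<in> iso ar A (?Q\<lparr>carrier := ?B\<rparr>)"
    using inj' h'op by (auto simp: iso_def hom_def bij_betw_def h'_def)
  moreover have "(\<lambda>p. s (c p)) \<in> J \<rightarrow> K" using s cI by auto
  ultimately show ?thesis unfolding ISP_def using A by blast
qed


datatype lat_sym = Join | Meet

definition lat_ar :: "lat_sym \<Rightarrow> nat" where
  "lat_ar = (\<lambda>_. 2)"

definition Du :: "(lat_sym, 'a) alg set" where
  "Du = {L. is_algebra lat_ar L \<and>
     (let j = (\<lambda>x y. opn L Join [x, y]); m = (\<lambda>x y. opn L Meet [x, y]) in
      \<forall>x \<in> carrier L. \<forall>y \<in> carrier L. \<forall>z \<in> carrier L.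
        j x y = j y x \<and> m x y = m y x \<and>
        j (j x y) z = j x (j y z) \<and> m (m x y) z = m x (m y z) \<and>
        j x (m x y) = x \<and> m x (j x y) = x \<and>
        m x (j y z) = j (m x y) (m x z))}"

text \<open>The two-element lattice on \<open>bool\<close>, with \<open>False < True\<close>.\<close>

definition two :: "(lat_sym, bool) alg" where
  "two = \<lparr>carrier = UNIV,
          opn = (\<lambda>f xs. case f of Join \<Rightarrow> sup (xs ! 0) (xs ! 1) | Meet \<Rightarrow> inf (xs ! 0) (xs ! 1))\<rparr>"


datatype 'f trm = Var nat | App 'f "'f trm list"

inductive wf_trm :: "('f \<Rightarrow> nat) \<Rightarrow> nat \<Rightarrow> 'f trm \<Rightarrow> bool" for ar n where
  "i < n \<Longrightarrow> wf_trm ar n (Var i)"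
| "length ts = ar f \<Longrightarrow> (\<And>t. t \<in> set ts \<Longrightarrow> wf_trm ar n t) \<Longrightarrow> wf_trm ar n (App f ts)"

primrec trm_val :: "('f, 'a) alg \<Rightarrow> (nat \<Rightarrow> 'a) \<Rightarrow> 'f trm \<Rightarrow> 'a" where
  "trm_val A v (Var i) = v i"
| "trm_val A v (App f ts) = opn A f (map (trm_val A v) ts)"

text \<open>\<open>L\<close> is a reduct of \<open>A\<close>: it has the same universe, and each of its operations is a term
  operation of \<open>A\<close> (for instance a fundamental operation of \<open>A\<close>).\<close>

definition reduct :: "('f \<Rightarrow> nat) \<Rightarrow> ('g \<Rightarrow> nat) \<Rightarrow> ('f, 'a) alg \<Rightarrow> ('g, 'a) alg \<Rightarrow> bool" where
  "reduct ar ar' A L \<longleftrightarrow> carrier L = carrier A \<and>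
     (\<forall>g. \<exists>t. wf_trm ar (ar' g) t \<and>
        (\<forall>xs \<in> args ar' g (carrier A). opn L g xs = trm_val A (\<lambda>i. xs ! i) t))"

text \<open>A functor that is the identity on underlying maps is given by its action on objects; the
  functor laws are then automatic.\<close>

definition forgetful_functor_Du ::
  "('f \<Rightarrow> nat) \<Rightarrow> ('f, 'a) alg set \<Rightarrow> (('f, 'a) alg \<Rightarrow> (lat_sym, 'a) alg) \<Rightarrow> bool" where
  "forgetful_functor_Du ar \<A> U \<longleftrightarrow>
     (\<forall>A \<in> \<A>. U A \<in> Du \<and> reduct ar lat_ar A (U A)) \<and>
     (\<forall>A \<in> \<A>. \<forall>B \<in> \<A>. hom ar A B \<subseteq> hom lat_ar (U A) (U B))"


text \<open>The sorts form a family \<open>M k\<close>, \<open>k \<in> K\<close>; they are made disjoint by tagging each element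
  with its label \<open>k\<close>. Accordingly \<open>\<Omega> k\<close> is the set of carriers of the sort \<open>M k\<close>, and
  \<open>G j k\<close> is the set of those members of \<open>G\<close> that are homomorphisms from \<open>M j\<close> to \<open>M k\<close>.\<close>

definition Sep ::
  "'k set \<Rightarrow> ('k \<Rightarrow> ('f, 'a) alg) \<Rightarrow> ('k \<Rightarrow> 'k \<Rightarrow> ('a \<Rightarrow> 'a) set) \<Rightarrow> ('k \<Rightarrow> ('a \<Rightarrow> bool) set) \<Rightarrow> bool"
where
  "Sep K M G \<Omega> \<longleftrightarrow>
     (\<forall>j \<in> K. \<forall>a \<in> carrier (M j). \<forall>b \<in> carrier (M j). a \<noteq> b \<longrightarrow>
        (\<exists>\<omega> \<in> \<Omega> j. \<omega> a \<noteq> \<omega> b) \<or>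
        (\<exists>k \<in> K. \<exists>\<omega>' \<in> \<Omega> k. \<exists>u \<in> G j k. \<omega>' (u a) \<noteq> \<omega>' (u b)))"

definition leq_preimage ::
  "('f, 'a) alg \<Rightarrow> ('f, 'b) alg \<Rightarrow> ('a \<Rightarrow> bool) \<Rightarrow> ('b \<Rightarrow> bool) \<Rightarrow> ('a \<times> 'b) set" where
  "leq_preimage A B \<omega> \<omega>' = {(a, b) \<in> carrier A \<times> carrier B. \<omega> a \<le> \<omega>' b}"

definition max_subalgebras ::
  "('f \<Rightarrow> nat) \<Rightarrow> ('f, 'a) alg \<Rightarrow> ('f, 'b) alg \<Rightarrow> ('a \<Rightarrow> bool) \<Rightarrow> ('b \<Rightarrow> bool) \<Rightarrow> ('a \<times> 'b) set set"
where
  "max_subalgebras ar A B \<omega> \<omega>' =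
     {r. subalgebra ar r (pair_alg A B) \<and> r \<subseteq> leq_preimage A B \<omega> \<omega>' \<and>
         (\<forall>r'. subalgebra ar r' (pair_alg A B) \<and> r' \<subseteq> leq_preimage A B \<omega> \<omega>' \<and> r \<subseteq> r'
               \<longrightarrow> r' = r)}"


text \<open>The sets \<open>G\<close>, \<open>R\<close>, \<open>S\<close> of an alter ego, broken up by sorts: members of \<open>rels j k\<close> are subsets of
  \<open>M j \<times> M k\<close> and members of \<open>preds k\<close> are subsets of \<open>M k\<close>. They serve both as relations on the
  alter ego and as the symbols that are interpreted in the dual structures.\<close>

record ('k, 'a) grs =
  funs :: "'k \<Rightarrow> 'k \<Rightarrow> ('a \<Rightarrow> 'a) set"
  rels :: "'k \<Rightarrow> 'k \<Rightarrow> ('a \<times> 'a) set set"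
  preds :: "'k \<Rightarrow> 'a set set"

text \<open>Multisorted topological structures that interpret such symbols. A point of sort \<open>k\<close> is a
  pair \<open>(k, x)\<close>; \<open>space\<close> carries the topology of the disjoint union of the sorts.\<close>

record ('k, 'a, 'p) mstruct =
  space :: "('k \<times> 'p) topology"
  fun_int :: "'k \<Rightarrow> 'k \<Rightarrow> ('a \<Rightarrow> 'a) \<Rightarrow> 'p \<Rightarrow> 'p"
  rel_int :: "'k \<Rightarrow> 'k \<Rightarrow> ('a \<times> 'a) set \<Rightarrow> ('p \<times> 'p) set"
  pred_int :: "'k \<Rightarrow> 'a set \<Rightarrow> 'p set"

abbreviation points :: "('k, 'a, 'p) mstruct \<Rightarrow> ('k \<times> 'p) set" where
  "points X \<equiv> topspace (space X)"

definition alter_ego :: "'k set \<Rightarrow> ('k \<Rightarrow> ('f, 'a) alg) \<Rightarrow> ('k, 'a, 'a) mstruct" where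
  "alter_ego K M =
     \<lparr>space = sum_topology (\<lambda>k. discrete_topology (carrier (M k))) K,
      fun_int = (\<lambda>j k g. g),
      rel_int = (\<lambda>j k r. r),
      pred_int = (\<lambda>k s. s)\<rparr>"

definition dual ::
  "('f \<Rightarrow> nat) \<Rightarrow> 'k set \<Rightarrow> ('k \<Rightarrow> ('f, 'm) alg) \<Rightarrow> ('f, 'a) alg \<Rightarrow> ('k, 'm, 'a \<Rightarrow> 'm) mstruct" where
  "dual ar K M A =
     \<lparr>space = sum_topology (\<lambda>k.
        subtopology (product_topology (\<lambda>_. discrete_topology (carrier (M k))) (carrier A))
                    (hom ar A (M k))) K,
      fun_int = (\<lambda>j k g x. compose (carrier A) g x),
      rel_int = (\<lambda>j k r. {(x, x'). x \<in> hom ar A (M j) \<and> x' \<in> hom ar A (M k) \<and>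
                                   (\<forall>a \<in> carrier A. (x a, x' a) \<in> r)}),
      pred_int = (\<lambda>k s. {x \<in> hom ar A (M k). \<forall>a \<in> carrier A. x a \<in> s})\<rparr>"

text \<open>\<open>morphism K \<Sigma> X Y \<alpha>\<close>: the family of maps \<open>\<alpha> k\<close> from the sort \<open>k\<close> of \<open>X\<close> to the sort \<open>k\<close>
  of \<open>Y\<close> is a continuous structure-preserving map.\<close>

definition morphism ::
  "'k set \<Rightarrow> ('k, 'a) grs \<Rightarrow> ('k, 'a, 'p) mstruct \<Rightarrow> ('k, 'a, 'q) mstruct
     \<Rightarrow> ('k \<Rightarrow> 'p \<Rightarrow> 'q) \<Rightarrow> bool" where
  "morphism K \<Sigma> X Y \<alpha> \<longleftrightarrow>
     continuous_map (space X) (space Y) (\<lambda>(k, x). (k, \<alpha> k x)) \<and>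
     (\<forall>j \<in> K. \<forall>k \<in> K. \<forall>g \<in> funs \<Sigma> j k. \<forall>x. (j, x) \<in> points X \<longrightarrow>
        \<alpha> k (fun_int X j k g x) = fun_int Y j k g (\<alpha> j x)) \<and>
     (\<forall>j \<in> K. \<forall>k \<in> K. \<forall>r \<in> rels \<Sigma> j k. \<forall>(x, x') \<in> rel_int X j k r.
        (\<alpha> j x, \<alpha> k x') \<in> rel_int Y j k r) \<and>
     (\<forall>k \<in> K. \<forall>s \<in> preds \<Sigma> k. \<forall>x \<in> pred_int X k s. \<alpha> k x \<in> pred_int Y k s)"

text \<open>\<open>hom_alg K M \<Sigma> X\<close> is the algebra of morphisms from \<open>X\<close> to the alter ego, inside the product of
  the powers of the sorts, i.e. the product over all points \<open>(k, x)\<close> of \<open>X\<close> of the algebras \<open>M k\<close>.\<close>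

definition hom_alg ::
  "'k set \<Rightarrow> ('k \<Rightarrow> ('f, 'a) alg) \<Rightarrow> ('k, 'a) grs \<Rightarrow> ('k, 'a, 'p) mstruct
     \<Rightarrow> ('f, 'k \<times> 'p \<Rightarrow> 'a) alg" where
  "hom_alg K M \<Sigma> X =
     (let P = prod_alg (points X) (\<lambda>(k, x). M k)
      in P\<lparr>carrier := {\<alpha> \<in> carrier P. morphism K \<Sigma> X (alter_ego K M) (\<lambda>k x. \<alpha> (k, x))}\<rparr>)"

definition evaluation ::
  "('f \<Rightarrow> nat) \<Rightarrow> 'k set \<Rightarrow> ('k \<Rightarrow> ('f, 'm) alg) \<Rightarrow> ('f, 'a) alg
     \<Rightarrow> 'a \<Rightarrow> 'k \<times> ('a \<Rightarrow> 'm) \<Rightarrow> 'm" where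
  "evaluation ar K M A = (\<lambda>a \<in> carrier A. \<lambda>(k, x) \<in> points (dual ar K M A). x a)"

definition yields_duality ::
  "('f \<Rightarrow> nat) \<Rightarrow> 'k set \<Rightarrow> ('k \<Rightarrow> ('f, 'm) alg) \<Rightarrow> ('k, 'm) grs \<Rightarrow> ('f, 'a) alg set \<Rightarrow> bool"
where
  "yields_duality ar K M \<Sigma> \<A> \<longleftrightarrow>
     (\<forall>A \<in> \<A>. evaluation ar K M A \<in> iso ar A (hom_alg K M \<Sigma> (dual ar K M A)))"

end

theory Submission
  imports Defs
begin

text \<open>The evaluation map is always an embedding, so the content is that every morphism \<open>\<alpha>\<close> from the
  dual of \<open>A\<close> to the alter ego is evaluation at some element of \<open>A\<close>. The carriers turn this into a
  question about the lattice reduct of \<open>A\<close>. A point \<open>x\<close> of sort \<open>k\<close> and a carrier \<open>\<omega>\<close> of that sort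
  give a lattice homomorphism \<open>\<omega> \<circ> x\<close> into the two-element lattice, and \<open>\<alpha>\<close> assigns to it the
  truth value \<open>\<omega> (\<alpha> x)\<close>. The element sought is an \<open>a\<close> with \<open>\<omega> (x a) = \<omega> (\<alpha> x)\<close> for all
  \<open>x\<close> and \<open>\<omega>\<close>.

  Preservation of \<open>R\<close> says that the assignment is order preserving: if \<open>\<omega> \<circ> x \<le> \<omega>' \<circ> y\<close>
  pointwise, then the joint image of \<open>x\<close> and \<open>y\<close> is a subalgebra inside the preimage of the order,
  so it lies in a member of \<open>R\<close>, which forces \<open>\<omega> (\<alpha> x) \<le> \<omega>' (\<alpha> y)\<close>. Hence no homomorphism
  with value true lies below one with value false (\<open>level_sets_not_below\<close>), and any two such
  homomorphisms are told apart, in the right direction, by an element of \<open>A\<close>. Continuity of \<open>\<alpha>\<close>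
  makes the two sets of homomorphisms compact (\<open>compactin_level_set\<close>), so finitely many elements
  suffice, and meets and joins combine them into one element \<open>a\<close> (\<open>compact_separation\<close>).

  As the lattices have no bounds, empty meets and joins must be excluded, that is, both sets must be
  nonempty. This is what \<open>S\<close> provides: the constant homomorphisms onto the one-element subalgebras
  \<open>{d1}\<close> and \<open>{d0}\<close> are points of the dual at which \<open>\<alpha>\<close> is forced to take the values \<open>d1\<close> and
  \<open>d0\<close> (\<open>level_set_nonempty\<close>).

  Agreement after applying all carriers is upgraded to \<open>\<alpha> x = x a\<close> by the separation condition and
  preservation of \<open>G\<close> (\<open>morphism_eq_evaluation\<close>).\<close>

section \<open>Homomorphisms and subalgebras\<close>

lemma is_algebra_closed:
  "is_algebra ar A \<Longrightarrow> xs \<in> args ar f (carrier A) \<Longrightarrow> opn A f xs \<in> carrier A"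
  by (simp add: is_algebra_def)

lemma hom_closed: "h \<in> hom ar A B \<Longrightarrow> a \<in> carrier A \<Longrightarrow> h a \<in> carrier B"
  by (auto simp: hom_def)

lemma hom_opn:
  "h \<in> hom ar A B \<Longrightarrow> xs \<in> args ar f (carrier A) \<Longrightarrow> h (opn A f xs) = opn B f (map h xs)"
  by (simp add: hom_def)

lemma args_map:
  "xs \<in> args ar f A \<Longrightarrow> (\<And>a. a \<in> A \<Longrightarrow> h a \<in> B) \<Longrightarrow> map h xs \<in> args ar f B"
  by (auto simp: args_def)

lemma args_image:
  assumes "xs \<in> args ar f (h ` A)"
  obtains ys where "ys \<in> args ar f A" "xs = map h ys"
proof -
  have "xs \<in> lists (h ` A)"
    using assms by (auto simp: args_def)
  then obtain ys where "ys \<in> lists A" "xs = map h ys"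
    by (auto simp: lists_image)
  with assms show thesis
    by (intro that) (auto simp: args_def)
qed

lemma hom_compose:
  assumes A: "is_algebra ar A" and x: "x \<in> hom ar A B" and g: "g \<in> hom ar B C"
  shows "compose (carrier A) g x \<in> hom ar A C"
proof -
  have "compose (carrier A) g x (opn A f xs) = opn C f (map (compose (carrier A) g x) xs)"
    if xs: "xs \<in> args ar f (carrier A)" for f xs
  proof -
    have "map (compose (carrier A) g x) xs = map g (map x xs)"
      using xs by (auto simp: args_def compose_def)
    moreover have "map x xs \<in> args ar f (carrier B)"
      using xs hom_closed[OF x] by (rule args_map)
    ultimately show ?thesis
      using is_algebra_closed[OF A xs] hom_opn[OF x xs] hom_opn[OF g]
      by (simp add: compose_def del: map_map map_eq_conv)
  qed
  then show ?thesis
    using hom_closed[OF x] hom_closed[OF g] unfolding hom_def by (auto simp: compose_def)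
qed

lemma const_hom:
  assumes A: "is_algebra ar A" and d: "subalgebra ar {d} B"
  shows "(\<lambda>a\<in>carrier A. d) \<in> hom ar A B"
proof -
  have "opn B f (map (\<lambda>a\<in>carrier A. d) xs) = d" if "xs \<in> args ar f (carrier A)" for f xs
  proof -
    have "map (\<lambda>a\<in>carrier A. d) xs \<in> args ar f {d}"
      using that by (rule args_map) simp
    then show ?thesis
      using d by (fastforce simp: subalgebra_def is_algebra_def)
  qed
  then show ?thesis
    using d is_algebra_closed[OF A] by (auto simp: hom_def subalgebra_def)
qed

lemma subalgebra_pair_image:
  assumes A: "is_algebra ar A" and x: "x \<in> hom ar A B" and y: "y \<in> hom ar A C"
  shows "subalgebra ar ((\<lambda>a. (x a, y a)) ` carrier A) (pair_alg B C)"
proof -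
  have "opn (pair_alg B C) f ps \<in> (\<lambda>a. (x a, y a)) ` carrier A"
    if "ps \<in> args ar f ((\<lambda>a. (x a, y a)) ` carrier A)" for f ps
  proof -
    obtain as where as: "as \<in> args ar f (carrier A)" "ps = map (\<lambda>a. (x a, y a)) as"
      using \<open>ps \<in> _\<close> by (rule args_image)
    then have "opn (pair_alg B C) f ps = (x (opn A f as), y (opn A f as))"
      by (simp add: pair_alg_def comp_def hom_opn[OF x as(1)] hom_opn[OF y as(1)])
    then show ?thesis
      using is_algebra_closed[OF A as(1)] by blast
  qed
  then show ?thesis
    using A hom_closed[OF x] hom_closed[OF y]
    unfolding subalgebra_def is_algebra_def by (auto simp: pair_alg_def)
qed

text \<open>This makes the forgetful functor applicable to the homomorphisms from an algebra of the class
  to a sort.\<close>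

lemma sort_in_ISP:
  fixes M :: "'k \<Rightarrow> ('f, 'm) alg"
  assumes k: "k \<in> K" and Mk: "is_algebra ar (M k)"
  shows "M k \<in> ISP ar K M"
proof (rule ISP_I)
  let ?P = "prod_alg (UNIV :: unit set) (\<lambda>i. M ((\<lambda>_. k) i))"
  show "is_algebra ar (M k)" by fact
  show "(\<lambda>_. k) \<in> (UNIV :: unit set) \<rightarrow> K" using k by simp
  have "opn ?P f xs \<in> carrier ?P" if "xs \<in> args ar f (carrier ?P)" for f xs
  proof -
    have "map (\<lambda>x. x ()) xs \<in> args ar f (carrier (M k))"
      using that by (rule args_map) (auto simp: prod_alg_def)
    then show ?thesis
      using is_algebra_closed[OF Mk] by (simp add: prod_alg_def)
  qed
  moreover have "carrier ?P \<noteq> {}"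
    using Mk by (auto simp: prod_alg_def is_algebra_def PiE_eq_empty_iff)
  ultimately show "subalgebra ar (carrier ?P) ?P"
    by (simp add: subalgebra_def is_algebra_def)
  let ?h = "\<lambda>a\<in>carrier (M k). \<lambda>_::unit. a"
  have "?h (opn (M k) f xs) = opn ?P f (map ?h xs)" if "xs \<in> args ar f (carrier (M k))" for f xs
  proof -
    have "map ((\<lambda>x. x ()) \<circ> ?h) xs = xs"
      using that by (intro map_idI) (auto simp: args_def)
    then show ?thesis
      using is_algebra_closed[OF Mk that] by (auto simp: prod_alg_def)
  qed
  moreover have "bij_betw ?h (carrier (M k)) (carrier ?P)"
  proof (rule bij_betw_byWitness[where f' = "\<lambda>x. x ()"])
  qed (auto simp: prod_alg_def)
  ultimately show "?h \<in> iso ar (M k) (?P\<lparr>carrier := carrier ?P\<rparr>)"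
    by (auto simp: iso_def hom_def bij_betw_def)
qed

lemma ISP_homs_separate:
  fixes A :: "('f, 'a) alg" and M :: "'k \<Rightarrow> ('f, 'm) alg"
  assumes A: "A \<in> ISP ar K M" and ab: "a \<in> carrier A" "b \<in> carrier A" "a \<noteq> b"
  obtains k x where "k \<in> K" "x \<in> hom ar A (M k)" "x a \<noteq> x b"
proof -
  obtain I :: "('a \<times> 'a) set" and s B h
    where s: "s \<in> I \<rightarrow> K" and B: "subalgebra ar B (prod_alg I (\<lambda>i. M (s i)))"
      and h: "h \<in> iso ar A ((prod_alg I (\<lambda>i. M (s i)))\<lparr>carrier := B\<rparr>)"
    using A unfolding ISP_def by blast
  have alg: "is_algebra ar A" using A by (simp add: ISP_def)
  have hP: "h c \<in> (\<Pi>\<^sub>E i\<in>I. carrier (M (s i)))" if "c \<in> carrier A" for c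
    using h B that by (auto simp: iso_def hom_def subalgebra_def prod_alg_def)
  have "h a \<noteq> h b"
    using h ab by (auto simp: iso_def bij_betw_def inj_on_def)
  then obtain i where i: "i \<in> I" "h a i \<noteq> h b i"
    using PiE_ext[OF hP hP] ab by blast
  let ?x = "\<lambda>c\<in>carrier A. h c i"
  have "?x (opn A f xs) = opn (M (s i)) f (map ?x xs)" if xs: "xs \<in> args ar f (carrier A)" for f xs
  proof -
    have "h (opn A f xs) = opn (prod_alg I (\<lambda>i. M (s i))) f (map h xs)"
      using h xs by (simp add: iso_def hom_def)
    moreover have "map ?x xs = map ((\<lambda>x. x i) \<circ> h) xs"
      using xs by (auto simp: args_def)
    ultimately show ?thesis
      using i is_algebra_closed[OF alg xs] by (simp add: prod_alg_def del: map_eq_conv)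
  qed
  moreover have "h c i \<in> carrier (M (s i))" if "c \<in> carrier A" for c
    using hP[OF that] i by blast
  ultimately have "?x \<in> hom ar A (M (s i))"
    by (auto simp: hom_def)
  moreover have "s i \<in> K" using s i by auto
  ultimately show thesis using that ab i by simp
qed

text \<open>Only finitely many subsets of a product of two finite algebras exist, so every subalgebra
  inside the preimage of the order extends to a maximal one.\<close>

lemma subalgebra_below_max:
  assumes fin: "finite (carrier A)" "finite (carrier B)"
    and r0: "subalgebra ar r0 (pair_alg A B)" "r0 \<subseteq> leq_preimage A B \<omega> \<omega>'"
  obtains r where "r \<in> max_subalgebras ar A B \<omega> \<omega>'" "r0 \<subseteq> r"
proof -
  let ?F = "{r. subalgebra ar r (pair_alg A B) \<and> r \<subseteq> leq_preimage A B \<omega> \<omega>'}"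
  have "?F \<subseteq> Pow (carrier A \<times> carrier B)"
    by (auto simp: subalgebra_def pair_alg_def)
  then have "finite ?F"
    using fin by (meson finite_Pow_iff finite_SigmaI finite_subset)
  then obtain r where "r \<in> ?F" "r0 \<subseteq> r" "\<forall>r' \<in> ?F. r \<subseteq> r' \<longrightarrow> r = r'"
    using r0 finite_has_maximal2[of ?F r0] by blast
  then show thesis
    by (intro that[of r]) (auto simp: max_subalgebras_def)
qed

section \<open>Compact sets of homomorphisms into the two-element lattice\<close>

lemma two_hom_Join:
  assumes "z \<in> hom lat_ar L two" "a \<in> carrier L" "b \<in> carrier L"
  shows "z (opn L Join [a, b]) \<longleftrightarrow> z a \<or> z b"
  using hom_opn[OF assms(1), of "[a, b]" Join] assms
  by (simp add: args_def lat_ar_def two_def)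

lemma two_hom_Meet:
  assumes "z \<in> hom lat_ar L two" "a \<in> carrier L" "b \<in> carrier L"
  shows "z (opn L Meet [a, b]) \<longleftrightarrow> z a \<and> z b"
  using hom_opn[OF assms(1), of "[a, b]" Meet] assms
  by (simp add: args_def lat_ar_def two_def)

lemma finite_join:
  assumes L: "is_algebra lat_ar L" and F: "finite F" "F \<noteq> {}" "F \<subseteq> carrier L"
  shows "\<exists>c\<in>carrier L. \<forall>z\<in>hom lat_ar L two. z c \<longleftrightarrow> (\<exists>a\<in>F. z a)"
  using F
proof (induction F rule: finite_ne_induct)
  case (insert a F)
  then obtain c where "c \<in> carrier L" "\<forall>z\<in>hom lat_ar L two. z c \<longleftrightarrow> (\<exists>a\<in>F. z a)"
    by blast
  moreover have "opn L Join [a, c] \<in> carrier L"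
    using insert.prems \<open>c \<in> carrier L\<close>
    by (intro is_algebra_closed[OF L]) (auto simp: args_def lat_ar_def)
  ultimately show ?case
    using insert.prems by (intro bexI[of _ "opn L Join [a, c]"]) (auto simp: two_hom_Join)
qed auto

lemma finite_meet:
  assumes L: "is_algebra lat_ar L" and F: "finite F" "F \<noteq> {}" "F \<subseteq> carrier L"
  shows "\<exists>c\<in>carrier L. \<forall>z\<in>hom lat_ar L two. z c \<longleftrightarrow> (\<forall>a\<in>F. z a)"
  using F
proof (induction F rule: finite_ne_induct)
  case (insert a F)
  then obtain c where "c \<in> carrier L" "\<forall>z\<in>hom lat_ar L two. z c \<longleftrightarrow> (\<forall>a\<in>F. z a)"
    by blast
  moreover have "opn L Meet [a, c] \<in> carrier L"
    using insert.prems \<open>c \<in> carrier L\<close>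
    by (intro is_algebra_closed[OF L]) (auto simp: args_def lat_ar_def)
  ultimately show ?case
    using insert.prems by (intro bexI[of _ "opn L Meet [a, c]"]) (auto simp: two_hom_Meet)
qed auto

abbreviation bool_power :: "'a set \<Rightarrow> ('a \<Rightarrow> bool) topology" where
  "bool_power C \<equiv> product_topology (\<lambda>_. discrete_topology UNIV) C"

text \<open>Fixing the value of one coordinate defines an open set of the power, so this is an instance of
  the open cover property.\<close>

lemma compact_finite_coordinates:
  assumes Z: "compactin (bool_power C) Z" and D: "D \<subseteq> C" and cover: "\<forall>z\<in>Z. \<exists>a\<in>D. z a = v"
  obtains F where "finite F" "F \<subseteq> D" "\<forall>z\<in>Z. \<exists>a\<in>F. z a = v"
proof -
  let ?U = "\<lambda>a. {z \<in> topspace (bool_power C). z a \<in> {v}}"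
  have "openin (bool_power C) (?U a)" if "a \<in> C" for a
    by (rule openin_continuous_map_preimage[OF continuous_map_product_projection[OF that]]) simp
  moreover have "Z \<subseteq> \<Union>(?U ` D)"
  proof
    fix z assume z: "z \<in> Z"
    from bspec[OF cover z] obtain a where "a \<in> D" "z a = v" ..
    moreover have "z \<in> topspace (bool_power C)"
      using compactin_subset_topspace[OF Z] z by blast
    ultimately show "z \<in> \<Union>(?U ` D)" by blast
  qed
  ultimately obtain \<F> where "finite \<F>" "\<F> \<subseteq> ?U ` D" "Z \<subseteq> \<Union>\<F>"
    using compactinD[OF Z, of "?U ` D"] D by blast
  then obtain F where F: "finite F" "F \<subseteq> D" "Z \<subseteq> \<Union>(?U ` F)"
    using finite_subset_image[of \<F> ?U D] by auto
  have "\<exists>a\<in>F. z a = v" if "z \<in> Z" for z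
    using subsetD[OF F(3) that] by simp
  then have "\<forall>z\<in>Z. \<exists>a\<in>F. z a = v" ..
  with F(1,2) show thesis by (rule that)
qed

text \<open>For a fixed \<open>p\<close>, compactness of \<open>Q\<close> leaves finitely many of the elements that separate \<open>p\<close>
  from the members of \<open>Q\<close>, and their meet separates \<open>p\<close> from all of \<open>Q\<close>. Compactness of \<open>P\<close> leaves
  finitely many of these meets, and their join is the required element. Nonemptiness of \<open>P\<close> and
  \<open>Q\<close> ensures that the join and the meets are over nonempty sets, as they must be in a lattice
  without bounds. This is the form in which Priestley duality enters.\<close>

lemma compact_separation:
  assumes L: "is_algebra lat_ar L"
    and hom: "P \<subseteq> hom lat_ar L two" "Q \<subseteq> hom lat_ar L two"
    and compact: "compactin (bool_power (carrier L)) P" "compactin (bool_power (carrier L)) Q"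
    and ne: "P \<noteq> {}" "Q \<noteq> {}"
    and sep: "\<And>p q. p \<in> P \<Longrightarrow> q \<in> Q \<Longrightarrow> \<exists>a\<in>carrier L. p a \<and> \<not> q a"
  shows "\<exists>a\<in>carrier L. (\<forall>p\<in>P. p a) \<and> (\<forall>q\<in>Q. \<not> q a)"
proof -
  let ?D = "{a \<in> carrier L. \<forall>q\<in>Q. \<not> q a}"
  have "\<exists>a\<in>?D. p a = True" if p: "p \<in> P" for p
  proof -
    let ?C = "{a \<in> carrier L. p a}"
    have "\<exists>a\<in>?C. q a = False" if "q \<in> Q" for q
      using sep[OF p that] by auto
    then have "\<forall>q\<in>Q. \<exists>a\<in>?C. q a = False" ..
    then obtain F where F: "finite F" "F \<subseteq> ?C" "\<forall>q\<in>Q. \<exists>a\<in>F. q a = False"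
      by (rule compact_finite_coordinates[OF compact(2) Collect_subset])
    have "F \<noteq> {}" using F(3) ne by blast
    then obtain c where c: "c \<in> carrier L" "\<forall>z\<in>hom lat_ar L two. z c \<longleftrightarrow> (\<forall>a\<in>F. z a)"
      using finite_meet[OF L F(1)] F(2) by blast
    have "\<not> q c" if q: "q \<in> Q" for q
      using bspec[OF c(2) subsetD[OF hom(2) q]] bspec[OF F(3) q] by auto
    then have "\<forall>q\<in>Q. \<not> q c" ..
    with c(1) have "c \<in> ?D" by (intro CollectI conjI)
    moreover have "p c = True"
      using bspec[OF c(2) subsetD[OF hom(1) p]] F(2) by auto
    ultimately show ?thesis by (rule bexI[rotated])
  qed
  then have "\<forall>p\<in>P. \<exists>a\<in>?D. p a = True" ..
  then obtain F where F: "finite F" "F \<subseteq> ?D" "\<forall>p\<in>P. \<exists>a\<in>F. p a = True"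
    by (rule compact_finite_coordinates[OF compact(1) Collect_subset])
  have "F \<noteq> {}" using F(3) ne by blast
  then obtain c where c: "c \<in> carrier L" "\<forall>z\<in>hom lat_ar L two. z c \<longleftrightarrow> (\<exists>a\<in>F. z a)"
    using finite_join[OF L F(1)] F(2) by blast
  have "p c" if p: "p \<in> P" for p
    using bspec[OF c(2) subsetD[OF hom(1) p]] bspec[OF F(3) p] by auto
  then have P: "\<forall>p\<in>P. p c" ..
  have "\<not> q c" if q: "q \<in> Q" for q
  proof -
    have "\<not> q a" if "a \<in> F" for a
      using subsetD[OF F(2) that] q by auto
    then show ?thesis
      using bspec[OF c(2) subsetD[OF hom(2) q]] by auto
  qed
  then have "\<forall>q\<in>Q. \<not> q c" ..
  with P c(1) show ?thesis by (intro bexI[of _ c] conjI)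
qed

section \<open>The topology of the dual\<close>

definition hom_space ::
  "('f \<Rightarrow> nat) \<Rightarrow> ('f, 'a) alg \<Rightarrow> ('f, 'b) alg \<Rightarrow> ('a \<Rightarrow> 'b) topology" where
  "hom_space ar A B =
     subtopology (product_topology (\<lambda>_. discrete_topology (carrier B)) (carrier A)) (hom ar A B)"

lemma topspace_hom_space [simp]: "topspace (hom_space ar A B) = hom ar A B"
  by (auto simp: hom_space_def hom_def)

lemma space_dual: "space (dual ar K M A) = sum_topology (\<lambda>k. hom_space ar A (M k)) K"
  by (simp add: dual_def hom_space_def)

lemma points_dual: "points (dual ar K M A) = Sigma K (\<lambda>k. hom ar A (M k))"
  by (simp add: space_dual comp_def)

lemma openin_agree_on_finite:
  assumes "finite F" "F \<subseteq> C"
  shows "openin (product_topology (\<lambda>_. discrete_topology D) C) {h' \<in> C \<rightarrow>\<^sub>E D. \<forall>c\<in>F. h' c = h c}"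
  using assms
proof (induction F rule: finite_induct)
  case empty
  then show ?case
    using openin_topspace[of "product_topology (\<lambda>_. discrete_topology D) C"] by simp
next
  case (insert a F)
  let ?T = "product_topology (\<lambda>_. discrete_topology D) C"
  have "openin ?T {h' \<in> topspace ?T. h' a \<in> {h a} \<inter> D}"
    using insert.prems
    by (intro openin_continuous_map_preimage[OF continuous_map_product_projection]) auto
  then have "openin ?T ({h' \<in> topspace ?T. h' a \<in> {h a} \<inter> D} \<inter> {h' \<in> C \<rightarrow>\<^sub>E D. \<forall>c\<in>F. h' c = h c})"
    using insert by (intro openin_Int) auto
  also have "\<dots> = {h' \<in> C \<rightarrow>\<^sub>E D. \<forall>c\<in>insert a F. h' c = h c}"
    using insert.prems by (auto simp: PiE_def Pi_def)
  finally show ?case .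
qed

text \<open>Failure to preserve an operation on a given tuple is visible on the finitely many entries of
  the tuple together with its value, hence is an open condition; so the homomorphisms are closed
  in a power of a finite discrete space.\<close>

lemma compact_space_hom_space:
  assumes A: "is_algebra ar A" and fin: "finite (carrier B)"
  shows "compact_space (hom_space ar A B)"
proof -
  let ?T = "product_topology (\<lambda>_. discrete_topology (carrier B)) (carrier A)"
  have "\<exists>V. openin ?T V \<and> h \<in> V \<and> V \<subseteq> topspace ?T - hom ar A B"
    if h: "h \<in> topspace ?T - hom ar A B" for h
  proof -
    obtain f xs where xs: "xs \<in> args ar f (carrier A)" "h (opn A f xs) \<noteq> opn B f (map h xs)"
      using h by (auto simp: hom_def)
    let ?F = "insert (opn A f xs) (set xs)"
    let ?V = "{h' \<in> carrier A \<rightarrow>\<^sub>E carrier B. \<forall>c\<in>?F. h' c = h c}"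
    have "openin ?T ?V"
      using xs is_algebra_closed[OF A xs(1)]
      by (intro openin_agree_on_finite) (auto simp: args_def)
    moreover have "h' \<notin> hom ar A B" if "h' \<in> ?V" for h'
    proof
      assume "h' \<in> hom ar A B"
      then have "h' (opn A f xs) = opn B f (map h' xs)"
        using xs(1) by (rule hom_opn)
      moreover have "map h' xs = map h xs" using that by auto
      ultimately show False using that xs(2) by simp
    qed
    ultimately show ?thesis
      using h by (intro exI[of _ ?V]) auto
  qed
  then have "openin ?T (topspace ?T - hom ar A B)"
    by (subst openin_subopen) blast
  then have "closedin ?T (hom ar A B)"
    by (auto simp: closedin_def hom_def)
  moreover have "compact_space ?T"
    using fin by (simp add: compact_space_product_topology compact_space_discrete_topology)
  ultimately show ?thesis
    unfolding hom_space_def by (simp add: closedin_compact_space compact_space_subtopology)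
qed

lemma continuous_map_compose_hom_space:
  "continuous_map (hom_space ar A B) (bool_power (carrier A)) (\<lambda>x. compose (carrier A) \<omega> x)"
proof -
  let ?T = "product_topology (\<lambda>_. discrete_topology (carrier B)) (carrier A)"
  have "continuous_map ?T (discrete_topology UNIV) (\<lambda>x. compose (carrier A) \<omega> x a)"
    if a: "a \<in> carrier A" for a
  proof -
    have "continuous_map ?T (discrete_topology UNIV) (\<omega> \<circ> (\<lambda>x. x a))"
      by (rule continuous_map_compose[OF continuous_map_product_projection[OF a]])
        (simp add: continuous_map_def)
    then show ?thesis
      using a by (simp add: comp_def compose_def)
  qed
  then have "continuous_map ?T (bool_power (carrier A)) (\<lambda>x. compose (carrier A) \<omega> x)"
    by (auto simp: continuous_map_componentwise compose_def)
  then show ?thesis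
    unfolding hom_space_def by (rule continuous_map_from_subtopology)
qed

text \<open>Both spaces are topological sums over the sorts and the map respects sorts, so continuity
  can be tested one sort at a time.\<close>

lemma continuous_map_dual_alter_ego_iff:
  assumes \<alpha>: "\<And>k x. k \<in> K \<Longrightarrow> x \<in> hom ar A (M k) \<Longrightarrow> \<alpha> k x \<in> carrier (M k)"
  shows "continuous_map (space (dual ar K M A)) (space (alter_ego K M)) (\<lambda>(k, x). (k, \<alpha> k x)) \<longleftrightarrow>
     (\<forall>k\<in>K. continuous_map (hom_space ar A (M k)) (discrete_topology (carrier (M k))) (\<alpha> k))"
    (is "?l \<longleftrightarrow> ?r")
proof
  assume l: ?l
  show ?r
  proof
    fix k assume k: "k \<in> K"
    have "openin (hom_space ar A (M k)) {x \<in> hom ar A (M k). \<alpha> k x \<in> V}"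
      if V: "V \<subseteq> carrier (M k)" for V
    proof -
      have "openin (space (alter_ego K M)) ({k} \<times> V)"
        using k V by (auto simp: alter_ego_def openin_sum_topology)
      from openin_continuous_map_preimage[OF l this]
      have "openin (hom_space ar A (M k))
          {x. (k, x) \<in> {p \<in> points (dual ar K M A). (\<lambda>(k, x). (k, \<alpha> k x)) p \<in> {k} \<times> V}}"
        using k unfolding space_dual openin_sum_topology by blast
      then show ?thesis
        using k by (simp add: points_dual)
    qed
    then show "continuous_map (hom_space ar A (M k)) (discrete_topology (carrier (M k))) (\<alpha> k)"
      using \<alpha>[OF k] by (auto simp: continuous_map_def)
  qed
next
  assume r: ?r
  have "openin (space (dual ar K M A))
      {p \<in> points (dual ar K M A). (\<lambda>(k, x). (k, \<alpha> k x)) p \<in> V}"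
    if V: "openin (space (alter_ego K M)) V" for V
  proof -
    have "openin (hom_space ar A (M k)) {x \<in> hom ar A (M k). (k, \<alpha> k x) \<in> V}" if k: "k \<in> K" for k
    proof -
      have "openin (discrete_topology (carrier (M k))) {a. (k, a) \<in> V}"
        using V k by (simp add: alter_ego_def openin_sum_topology)
      with openin_continuous_map_preimage[OF r[rule_format, OF k] this] show ?thesis
        by simp
    qed
    then show ?thesis
      by (auto simp: space_dual openin_sum_topology)
  qed
  then show ?l
    using \<alpha> by (auto simp: continuous_map_def points_dual alter_ego_def)
qed

section \<open>The evaluation map\<close>

lemma evaluation_apply:
  assumes "a \<in> carrier A"
  shows "evaluation ar K M A a = (\<lambda>(k, x) \<in> Sigma K (\<lambda>k. hom ar A (M k)). x a)"
  using assms by (simp add: evaluation_def points_dual)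

text \<open>The structure on the dual is pointwise: evaluation at \<open>a\<close> is a coordinate projection, hence
  continuous, and relations and predicates of the dual hold in every coordinate. Only the
  operations need an assumption, namely that composing with them leads from points to points.\<close>

lemma evaluation_morphism:
  assumes A: "is_algebra ar A" and a: "a \<in> carrier A"
    and funs: "\<And>j k. j \<in> K \<Longrightarrow> k \<in> K \<Longrightarrow> funs \<Sigma> j k \<subseteq> hom ar (M j) (M k)"
  shows "morphism K \<Sigma> (dual ar K M A) (alter_ego K M) (\<lambda>k x. evaluation ar K M A a (k, x))"
proof -
  have ev: "evaluation ar K M A a (k, x) = x a" if "k \<in> K" "x \<in> hom ar A (M k)" for k x
    using that by (simp add: evaluation_apply[OF a])
  have "continuous_map (hom_space ar A (M k)) (discrete_topology (carrier (M k)))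
      (\<lambda>x. evaluation ar K M A a (k, x))" if k: "k \<in> K" for k
  proof (rule continuous_map_eq)
    show "continuous_map (hom_space ar A (M k)) (discrete_topology (carrier (M k))) (\<lambda>x. x a)"
      unfolding hom_space_def
      by (intro continuous_map_from_subtopology continuous_map_product_projection a)
  qed (simp add: ev k)
  then have cont: "continuous_map (space (dual ar K M A)) (space (alter_ego K M))
      (\<lambda>(k, x). (k, evaluation ar K M A a (k, x)))"
    by (subst continuous_map_dual_alter_ego_iff) (auto simp: ev hom_closed a)
  have "evaluation ar K M A a (k, compose (carrier A) g x) = g (evaluation ar K M A a (j, x))"
    if "j \<in> K" "k \<in> K" "g \<in> funs \<Sigma> j k" "x \<in> hom ar A (M j)" for j k g x
  proof -
    have "compose (carrier A) g x \<in> hom ar A (M k)"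
      using that funs by (blast intro: hom_compose[OF A])
    then show ?thesis
      using that a by (simp add: ev compose_def)
  qed
  then show ?thesis
    using cont a unfolding morphism_def
    by (auto simp: points_dual dual_def[where M = M] alter_ego_def ev)
qed

lemma carrier_hom_alg:
  "\<alpha> \<in> carrier (hom_alg K M \<Sigma> (dual ar K M A)) \<longleftrightarrow>
     \<alpha> \<in> (\<Pi>\<^sub>E (k, x) \<in> Sigma K (\<lambda>k. hom ar A (M k)). carrier (M k)) \<and>
     morphism K \<Sigma> (dual ar K M A) (alter_ego K M) (\<lambda>k x. \<alpha> (k, x))"
  by (simp add: hom_alg_def Let_def prod_alg_def points_dual case_prod_unfold)

lemma evaluation_hom:
  assumes A: "is_algebra ar A"
    and funs: "\<And>j k. j \<in> K \<Longrightarrow> k \<in> K \<Longrightarrow> funs \<Sigma> j k \<subseteq> hom ar (M j) (M k)"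
  shows "evaluation ar K M A \<in> hom ar A (hom_alg K M \<Sigma> (dual ar K M A))"
proof -
  let ?e = "evaluation ar K M A" and ?E = "hom_alg K M \<Sigma> (dual ar K M A)"
  have "?e a \<in> carrier ?E" if a: "a \<in> carrier A" for a
    using evaluation_morphism[OF A a funs] hom_closed a
    by (auto simp: carrier_hom_alg evaluation_apply[OF a])
  moreover have "?e (opn A f xs) = opn ?E f (map ?e xs)" if xs: "xs \<in> args ar f (carrier A)" for f xs
  proof -
    have "map x xs = map (\<lambda>b. b (k, x)) (map ?e xs)" if "k \<in> K" "x \<in> hom ar A (M k)" for k x
      using xs that by (auto simp: args_def evaluation_apply)
    then show ?thesis
      using is_algebra_closed[OF A xs] xs
      by (auto simp: evaluation_apply hom_alg_def Let_def prod_alg_def points_dual hom_opn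
          simp del: map_map intro!: restrict_ext)
  qed
  ultimately show ?thesis
    by (auto simp: hom_def evaluation_def)
qed

lemma evaluation_inj_on:
  assumes A: "A \<in> ISP ar K M"
  shows "inj_on (evaluation ar K M A) (carrier A)"
proof (rule inj_onI, rule ccontr)
  fix a b assume ab: "a \<in> carrier A" "b \<in> carrier A" "a \<noteq> b"
    and eq: "evaluation ar K M A a = evaluation ar K M A b"
  obtain k x where "k \<in> K" "x \<in> hom ar A (M k)" "x a \<noteq> x b"
    using ISP_homs_separate[OF A ab] .
  with fun_cong[OF eq, of "(k, x)"] ab show False
    by (simp add: evaluation_apply)
qed

section \<open>The duality theorem\<close>

text \<open>For a morphism \<open>\<alpha>\<close> these are the level sets of the map \<open>\<omega> \<circ> x \<mapsto> \<omega> (\<alpha> x)\<close> induced by \<open>\<alpha>\<close>.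
  Working with the level sets instead of the induced map spares the proof that the map is well
  defined; it follows once a single element \<open>a\<close> realises both values.\<close>

definition level_set ::
  "('f \<Rightarrow> nat) \<Rightarrow> 'k set \<Rightarrow> ('k \<Rightarrow> ('f, 'm) alg) \<Rightarrow> ('k \<Rightarrow> ('m \<Rightarrow> bool) set) \<Rightarrow> ('f, 'a) alg
     \<Rightarrow> ('k \<times> ('a \<Rightarrow> 'm) \<Rightarrow> 'm) \<Rightarrow> bool \<Rightarrow> ('a \<Rightarrow> bool) set" where
  "level_set ar K M \<Omega> A \<alpha> v =
     (\<Union>k\<in>K. \<Union>\<omega>\<in>\<Omega> k. compose (carrier A) \<omega> ` {x \<in> hom ar A (M k). \<omega> (\<alpha> (k, x)) = v})"

lemma level_setI:
  assumes "k \<in> K" "\<omega> \<in> \<Omega> k" "x \<in> hom ar A (M k)"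
  shows "compose (carrier A) \<omega> x \<in> level_set ar K M \<Omega> A \<alpha> (\<omega> (\<alpha> (k, x)))"
  unfolding level_set_def using assms(3) by (intro UN_I[OF assms(1)] UN_I[OF assms(2)] imageI) simp

text \<open>A level set is a finite union of continuous images of closed subsets of the compact spaces of
  homomorphisms into the sorts.\<close>

lemma compactin_level_set:
  assumes A: "is_algebra ar A" and fin: "finite K" "\<And>k. k \<in> K \<Longrightarrow> finite (carrier (M k))"
    "\<And>k. k \<in> K \<Longrightarrow> finite (\<Omega> k)"
    and \<alpha>: "\<alpha> \<in> carrier (hom_alg K M \<Sigma> (dual ar K M A))"
  shows "compactin (bool_power (carrier A)) (level_set ar K M \<Omega> A \<alpha> v)"
proof -
  have cont: "continuous_map (hom_space ar A (M k)) (discrete_topology (carrier (M k)))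
      (\<lambda>x. \<alpha> (k, x))" if k: "k \<in> K" for k
  proof -
    have "\<alpha> (k, x) \<in> carrier (M k)" if "k \<in> K" "x \<in> hom ar A (M k)" for k x
      using \<alpha> that by (fastforce simp: carrier_hom_alg PiE_def Pi_def)
    from iffD1[OF continuous_map_dual_alter_ego_iff[where \<alpha> = "\<lambda>k x. \<alpha> (k, x)", OF this]] \<alpha> k
    show ?thesis by (auto simp: carrier_hom_alg morphism_def)
  qed
  have "compactin (bool_power (carrier A))
      (compose (carrier A) \<omega> ` {x \<in> hom ar A (M k). \<omega> (\<alpha> (k, x)) = v})"
    if k: "k \<in> K" for k \<omega>
  proof (rule image_compactin[OF _ continuous_map_compose_hom_space])
    have "closedin (hom_space ar A (M k))
        {x \<in> topspace (hom_space ar A (M k)). \<alpha> (k, x) \<in> {a \<in> carrier (M k). \<omega> a = v}}"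
      by (rule closedin_continuous_map_preimage[OF cont[OF k]]) auto
    also have "\<dots> = {x \<in> hom ar A (M k). \<omega> (\<alpha> (k, x)) = v}"
      using continuous_map_funspace[OF cont[OF k]] by (auto simp: Pi_def)
    finally show "compactin (hom_space ar A (M k)) {x \<in> hom ar A (M k). \<omega> (\<alpha> (k, x)) = v}"
      using compact_space_hom_space[OF A fin(2)[OF k]] by (simp add: closedin_compact_space)
  qed
  then show ?thesis
    unfolding level_set_def using fin by (intro compactin_Union finite_imageI) (auto intro!: compactin_Union)
qed

text \<open>If \<open>p = \<omega> \<circ> x\<close> were below \<open>q = \<omega>' \<circ> y\<close>, then the subalgebra of all \<open>(x a, y a)\<close> would lie in a
  maximal one inside the preimage of the order. The morphism preserves the latter, so
  \<open>\<omega> (\<alpha> x) \<le> \<omega>' (\<alpha> y)\<close>, against the choice of \<open>p\<close> and \<open>q\<close>.\<close>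

lemma level_sets_not_below:
  assumes A: "is_algebra ar A" and fin: "\<And>k. k \<in> K \<Longrightarrow> finite (carrier (M k))"
    and rels: "\<And>j k \<omega> \<omega>'. j \<in> K \<Longrightarrow> k \<in> K \<Longrightarrow> \<omega> \<in> \<Omega> j \<Longrightarrow> \<omega>' \<in> \<Omega> k \<Longrightarrow>
      max_subalgebras ar (M j) (M k) \<omega> \<omega>' \<subseteq> rels \<Sigma> j k"
    and \<alpha>: "morphism K \<Sigma> (dual ar K M A) (alter_ego K M) (\<lambda>k x. \<alpha> (k, x))"
    and p: "p \<in> level_set ar K M \<Omega> A \<alpha> True" and q: "q \<in> level_set ar K M \<Omega> A \<alpha> False"
  shows "\<exists>a\<in>carrier A. p a \<and> \<not> q a"
proof (rule ccontr)
  assume neg: "\<not> (\<exists>a\<in>carrier A. p a \<and> \<not> q a)"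
  obtain j \<omega> x where j: "j \<in> K" "\<omega> \<in> \<Omega> j" "x \<in> hom ar A (M j)" "\<omega> (\<alpha> (j, x))"
    and p: "p = compose (carrier A) \<omega> x"
    using p by (auto simp: level_set_def)
  obtain k \<omega>' y where k: "k \<in> K" "\<omega>' \<in> \<Omega> k" "y \<in> hom ar A (M k)" "\<not> \<omega>' (\<alpha> (k, y))"
    and q: "q = compose (carrier A) \<omega>' y"
    using q by (auto simp: level_set_def)
  let ?r0 = "(\<lambda>a. (x a, y a)) ` carrier A"
  have "?r0 \<subseteq> leq_preimage (M j) (M k) \<omega> \<omega>'"
    using neg hom_closed[OF j(3)] hom_closed[OF k(3)]
    by (auto simp: leq_preimage_def p q compose_def)
  then obtain r where r: "r \<in> max_subalgebras ar (M j) (M k) \<omega> \<omega>'" "?r0 \<subseteq> r"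
    using subalgebra_below_max[OF fin[OF j(1)] fin[OF k(1)] subalgebra_pair_image[OF A j(3) k(3)]]
    by blast
  then have "(x, y) \<in> rel_int (dual ar K M A) j k r"
    using j k by (auto simp: dual_def)
  moreover have "r \<in> rels \<Sigma> j k"
    using rels[OF j(1) k(1) j(2) k(2)] r(1) by blast
  moreover have "\<forall>(x, x') \<in> rel_int (dual ar K M A) j k r.
      (\<alpha> (j, x), \<alpha> (k, x')) \<in> rel_int (alter_ego K M) j k r"
    if "r \<in> rels \<Sigma> j k"
    using \<alpha> j(1) k(1) that unfolding morphism_def by blast
  ultimately have "(\<alpha> (j, x), \<alpha> (k, y)) \<in> rel_int (alter_ego K M) j k r"
    by blast
  then have "(\<alpha> (j, x), \<alpha> (k, y)) \<in> r"
    by (simp add: alter_ego_def)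
  then show False
    using r(1) j k by (auto simp: max_subalgebras_def leq_preimage_def)
qed

text \<open>The constant map with value \<open>d\<close> is a point of the dual in the interpretation of the predicate
  \<open>{d}\<close>, which pins down its image under \<open>\<alpha>\<close>.\<close>

lemma level_set_nonempty:
  assumes A: "is_algebra ar A" and k: "k \<in> K" and d: "subalgebra ar {d} (M k)" "{d} \<in> preds \<Sigma> k"
    and \<omega>: "\<omega> \<in> \<Omega> k" "\<omega> d = v"
    and \<alpha>: "morphism K \<Sigma> (dual ar K M A) (alter_ego K M) (\<lambda>k x. \<alpha> (k, x))"
  shows "level_set ar K M \<Omega> A \<alpha> v \<noteq> {}"
proof -
  let ?x = "\<lambda>a\<in>carrier A. d"
  have x: "?x \<in> hom ar A (M k)"
    using const_hom[OF A d(1)] .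
  then have "?x \<in> pred_int (dual ar K M A) k {d}"
    by (simp add: dual_def)
  then have "\<alpha> (k, ?x) \<in> pred_int (alter_ego K M) k {d}"
    using \<alpha> k d(2) unfolding morphism_def by blast
  then have "\<omega> (\<alpha> (k, ?x)) = v"
    using \<omega>(2) by (simp add: alter_ego_def)
  moreover have "compose (carrier A) \<omega> ?x \<in> level_set ar K M \<Omega> A \<alpha> (\<omega> (\<alpha> (k, ?x)))"
    using k \<omega>(1) x by (rule level_setI)
  ultimately show ?thesis by auto
qed

text \<open>If \<open>\<alpha> x\<close> and \<open>x a\<close> differed, then by the separation condition a carrier would distinguish
  them, directly or after some \<open>u\<close> in \<open>G\<close>. In the second case the point \<open>u \<circ> x\<close> violates
  the agreement, because \<open>\<alpha> (u \<circ> x) = u (\<alpha> x)\<close>.\<close>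

lemma morphism_eq_evaluation:
  assumes A: "is_algebra ar A" and a: "a \<in> carrier A"
    and funs: "\<And>j k. j \<in> K \<Longrightarrow> k \<in> K \<Longrightarrow> funs \<Sigma> j k \<subseteq> hom ar (M j) (M k)"
    and Sep: "Sep K M (funs \<Sigma>) \<Omega>"
    and \<alpha>: "\<alpha> \<in> carrier (hom_alg K M \<Sigma> (dual ar K M A))"
    and agree: "\<forall>k\<in>K. \<forall>\<omega>\<in>\<Omega> k. \<forall>x\<in>hom ar A (M k). \<omega> (x a) = \<omega> (\<alpha> (k, x))"
  shows "\<alpha> = evaluation ar K M A a"
proof -
  have "\<alpha> (j, x) = x a" if j: "j \<in> K" and x: "x \<in> hom ar A (M j)" for j x
  proof (rule ccontr)
    assume ne: "\<alpha> (j, x) \<noteq> x a"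
    have \<alpha>x: "\<alpha> (j, x) \<in> carrier (M j)"
      using \<alpha> j x by (fastforce simp: carrier_hom_alg PiE_def Pi_def)
    from Sep[unfolded Sep_def, rule_format, OF j \<alpha>x hom_closed[OF x a] ne] show False
    proof (elim disjE bexE)
      fix \<omega>
      assume "\<omega> \<in> \<Omega> j" "\<omega> (\<alpha> (j, x)) \<noteq> \<omega> (x a)"
      then show False
        using agree[rule_format, OF j \<open>\<omega> \<in> \<Omega> j\<close> x] by simp
    next
      fix k \<omega> u
      assume 2: "k \<in> K" "\<omega> \<in> \<Omega> k" "u \<in> funs \<Sigma> j k" "\<omega> (u (\<alpha> (j, x))) \<noteq> \<omega> (u (x a))"
      have ux: "compose (carrier A) u x \<in> hom ar A (M k)"
        using hom_compose[OF A x subsetD[OF funs[OF j 2(1)] 2(3)]] .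
      have "(j, x) \<in> points (dual ar K M A)"
        using j x by (simp add: points_dual)
      then have "\<alpha> (k, fun_int (dual ar K M A) j k u x) = fun_int (alter_ego K M) j k u (\<alpha> (j, x))"
        using \<alpha> j 2(1,3) unfolding carrier_hom_alg morphism_def by blast
      then have "\<alpha> (k, compose (carrier A) u x) = u (\<alpha> (j, x))"
        by (simp add: dual_def alter_ego_def)
      then show False
        using agree[rule_format, OF 2(1,2) ux] 2(4) a by (simp add: compose_def)
    qed
  qed
  moreover have "\<alpha> \<in> extensional (Sigma K (\<lambda>k. hom ar A (M k)))"
    using \<alpha> by (simp add: carrier_hom_alg PiE_def)
  ultimately show ?thesis
    by (auto simp: evaluation_apply[OF a] fun_eq_iff extensional_def restrict_def)
qed

theorem theorem5p1:
  fixes ar :: "'f \<Rightarrow> nat"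
    and K :: "'k set"
    and M :: "'k \<Rightarrow> ('f, 'a) alg"
    and U :: "('f, 'a) alg \<Rightarrow> (lat_sym, 'a) alg"
    and \<Omega> :: "'k \<Rightarrow> ('a \<Rightarrow> bool) set"
    and G :: "'k \<Rightarrow> 'k \<Rightarrow> ('a \<Rightarrow> 'a) set"
    and R :: "'k \<Rightarrow> 'k \<Rightarrow> ('a \<times> 'a) set set"
    and S :: "'k \<Rightarrow> 'a set set"
    and k1 k0 :: 'k and d1 d0 :: 'a
    and \<A> :: "('f, 'a) alg set"
  assumes A1: "forgetful_functor_Du ar \<A> U"
    and A2: "finite K"
      "\<And>k. k \<in> K \<Longrightarrow> is_algebra ar (M k) \<and> finite (carrier (M k))"
      "\<A> = ISP ar K M"
    and A3: "\<And>k. k \<in> K \<Longrightarrow> \<Omega> k \<noteq> {} \<and> \<Omega> k \<subseteq> hom lat_ar (U (M k)) two"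
    and S1: "k1 \<in> K" "subalgebra ar {d1} (M k1)" "\<exists>\<omega> \<in> \<Omega> k1. \<omega> d1 = True"
    and S0: "k0 \<in> K" "subalgebra ar {d0} (M k0)" "\<exists>\<omega> \<in> \<Omega> k0. \<omega> d0 = False"
    and G: "\<And>j k. j \<in> K \<Longrightarrow> k \<in> K \<Longrightarrow> G j k \<subseteq> hom ar (M j) (M k)"
      "Sep K M G \<Omega>"
    and R: "\<And>j k. j \<in> K \<Longrightarrow> k \<in> K \<Longrightarrow>
      R j k = (\<Union>\<omega> \<in> \<Omega> j. \<Union>\<omega>' \<in> \<Omega> k. max_subalgebras ar (M j) (M k) \<omega> \<omega>')"
    and S: "\<And>k. k \<in> K \<Longrightarrow> S k = {s. k = k1 \<and> s = {d1} \<or> k = k0 \<and> s = {d0}}"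
  shows "yields_duality ar K M \<lparr>funs = G, rels = R, preds = S\<rparr> \<A>"
proof -
  let ?\<Sigma> = "\<lparr>funs = G, rels = R, preds = S\<rparr>"
  \<comment> \<open>Carriers are extensional maps from a finite set to the Booleans.\<close>
  have fin\<Omega>: "finite (\<Omega> k)" if k: "k \<in> K" for k
  proof (rule finite_subset)
    have "carrier (U (M k)) = carrier (M k)"
      using A1 A2 k sort_in_ISP[of k K ar M] by (simp add: forgetful_functor_Du_def reduct_def)
    then show "\<Omega> k \<subseteq> carrier (M k) \<rightarrow>\<^sub>E (UNIV :: bool set)"
      using A3[OF k] by (auto simp: hom_def two_def)
    show "finite (carrier (M k) \<rightarrow>\<^sub>E (UNIV :: bool set))"
      using A2(2)[OF k] by (intro finite_PiE) auto
  qed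
  have "evaluation ar K M A \<in> iso ar A (hom_alg K M ?\<Sigma> (dual ar K M A))" if A: "A \<in> \<A>" for A
  proof -
    let ?e = "evaluation ar K M A" and ?E = "hom_alg K M ?\<Sigma> (dual ar K M A)"
    have alg: "is_algebra ar A"
      using A A2(3) by (simp add: ISP_def)
    have UA: "is_algebra lat_ar (U A)" "carrier (U A) = carrier A"
      using A1 A by (auto simp: forgetful_functor_Du_def Du_def reduct_def)
    have hom_two: "compose (carrier A) \<omega> x \<in> hom lat_ar (U A) two"
      if k: "k \<in> K" and "\<omega> \<in> \<Omega> k" "x \<in> hom ar A (M k)" for k \<omega> x
    proof -
      have "M k \<in> \<A>"
        using A2 k by (simp add: sort_in_ISP)
      then have "x \<in> hom lat_ar (U A) (U (M k))"
        using A1 A that by (auto simp: forgetful_functor_Du_def)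
      then show ?thesis
        using hom_compose[OF UA(1), of x "U (M k)" \<omega> two] A3[OF k] that(2) UA(2) by auto
    qed
    have "\<alpha> \<in> ?e ` carrier A" if \<alpha>: "\<alpha> \<in> carrier ?E" for \<alpha>
    proof -
      let ?Z = "level_set ar K M \<Omega> A \<alpha>"
      have mor: "morphism K ?\<Sigma> (dual ar K M A) (alter_ego K M) (\<lambda>k x. \<alpha> (k, x))"
        using \<alpha> by (simp add: carrier_hom_alg)
      have Zhom: "?Z v \<subseteq> hom lat_ar (U A) two" for v
        using hom_two by (auto simp: level_set_def)
      have Zcompact: "compactin (bool_power (carrier (U A))) (?Z v)" for v
        unfolding UA(2) using A2(1,2) fin\<Omega> by (intro compactin_level_set[OF alg _ _ _ \<alpha>]) auto
      have Z1: "?Z True \<noteq> {}"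
      proof -
        obtain \<omega> where "\<omega> \<in> \<Omega> k1" "\<omega> d1 = True"
          using S1(3) by blast
        moreover have "{d1} \<in> preds ?\<Sigma> k1"
          using S[OF S1(1)] by simp
        ultimately show ?thesis
          using level_set_nonempty[OF alg S1(1,2) _ _ _ mor] by blast
      qed
      have Z0: "?Z False \<noteq> {}"
      proof -
        obtain \<omega> where "\<omega> \<in> \<Omega> k0" "\<omega> d0 = False"
          using S0(3) by blast
        moreover have "{d0} \<in> preds ?\<Sigma> k0"
          using S[OF S0(1)] by simp
        ultimately show ?thesis
          using level_set_nonempty[OF alg S0(1,2) _ _ _ mor] by blast
      qed
      have below: "\<exists>a\<in>carrier (U A). p a \<and> \<not> q a" if "p \<in> ?Z True" "q \<in> ?Z False" for p q
        unfolding UA(2)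
      proof (rule level_sets_not_below[OF alg _ _ mor that])
        show "finite (carrier (M k))" if "k \<in> K" for k
          using A2(2)[OF that] by blast
        show "max_subalgebras ar (M j) (M k) \<omega> \<omega>' \<subseteq> rels ?\<Sigma> j k"
          if "j \<in> K" "k \<in> K" "\<omega> \<in> \<Omega> j" "\<omega>' \<in> \<Omega> k" for j k \<omega> \<omega>'
          using R[OF that(1,2)] that(3,4) by auto
      qed
      obtain a where a: "a \<in> carrier A" "\<forall>p\<in>?Z True. p a" "\<forall>q\<in>?Z False. \<not> q a"
        using compact_separation[OF UA(1) Zhom Zhom Zcompact Zcompact Z1 Z0 below]
        unfolding UA(2) by blast
      have agree: "\<forall>k\<in>K. \<forall>\<omega>\<in>\<Omega> k. \<forall>x\<in>hom ar A (M k). \<omega> (x a) = \<omega> (\<alpha> (k, x))"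
      proof (intro ballI)
        fix k \<omega> x
        assume "k \<in> K" "\<omega> \<in> \<Omega> k" "x \<in> hom ar A (M k)"
        define v where "v = \<omega> (\<alpha> (k, x))"
        have z: "compose (carrier A) \<omega> x \<in> ?Z v"
          unfolding v_def by (rule level_setI) fact+
        have "compose (carrier A) \<omega> x a = v"
        proof (cases "v = True")
          case True
          with z bspec[OF a(2), of "compose (carrier A) \<omega> x"] show ?thesis by simp
        next
          case False
          then have "v = False" by simp
          with z bspec[OF a(3), of "compose (carrier A) \<omega> x"] show ?thesis by simp
        qed
        then show "\<omega> (x a) = \<omega> (\<alpha> (k, x))"
          using a(1) by (simp add: compose_def v_def)
      qed
      have "\<alpha> = ?e a"
      proof (rule morphism_eq_evaluation[OF alg a(1) _ _ \<alpha> agree])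
        show "funs ?\<Sigma> j k \<subseteq> hom ar (M j) (M k)" if "j \<in> K" "k \<in> K" for j k
          using G(1)[OF that] by simp
        show "Sep K M (funs ?\<Sigma>) \<Omega>"
          using G(2) by simp
      qed
      then show ?thesis
        using a(1) by blast
    qed
    moreover have "?e \<in> hom ar A ?E"
      using evaluation_hom[OF alg, of K ?\<Sigma> M] G(1) by simp
    moreover have "inj_on ?e (carrier A)"
      using evaluation_inj_on A A2(3) by blast
    ultimately show ?thesis
      using hom_closed[of ?e ar A ?E] unfolding iso_def bij_betw_def by blast
  qed
  then show ?thesis
    by (simp add: yields_duality_def)
qed

end
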